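(* Let $n\ge 2$, let $\alpha_1,\dots,\alpha_n\ge 0$ satisfy $\min(\alpha_1,\alpha_n)>0$ and $\sum_{j=1}^n\alpha_j=1$, and let $0<\delta<\frac12$. Then there exists a constant $C>0$ depending only on $\delta$, $\alpha_1$ and $\alpha_n$ such that the following holds. Let $\Omega\subset\mathbb{R}^n$ be a bounded domain, let $\varepsilon>0$, and let $u^\varepsilon$ be a function satisfying $$u^\varepsilon(x)=\sum_{j=1}^n\alpha_j\inf_{\dim(S)=j}\ \sup_{\substack{v\in S\\ |v|=1}}\frac{u^\varepsilon(x+\varepsilon v)+u^\varepsilon(x-\varepsilon v)}{2}\qquad\text{for every }x\in\Omega .$$ Then for every pair of concentric balls $B_r, B_{2r}$ with $B_{2r}\subset\Omega$ and all $x,z\in B_r$, $$|u^\varepsilon(x)-u^\varepsilon(z)|\le C\,\|u^\varepsilon\|_{L^\infty(B_{2r})}\left(\frac{|x-z|^\delta}{r^\delta}+\frac{\varepsilon^\delta}{r^\delta}\right).$$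
   Context: The infimum is over all $j$-dimensional linear subspaces $S$ of $\mathbb{R}^n$. The function $u^\varepsilon$ is real-valued, defined pointwise on (at least) $\Omega_\varepsilon=\{x+\varepsilon v: x\in\Omega,\ |v|\le 1\}$, and the equation (the dynamic programming principle) holds at every point of $\Omega$; terms with $\alpha_j=0$ are omitted. $B_r$ and $B_{2r}$ are open balls of radii $r$ and $2r$ with the same (arbitrary) center, $r>0$. $\|u\|_{L^\infty(B_{2r})}$ denotes $\sup_{B_{2r}}|u|$. *)

theory Defs
  imports "HOL-Analysis.Analysis"
begin

text \<open>
  The constant of the main result does not depend on the dimension, so the dimension has to be
  quantified inside a formula and cannot be a type parameter.  All spaces \<open>\<real>\<^sup>n\<close> are therefore
  realised inside one inner product space, that of the finitely supported real sequences with the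
  Euclidean inner product: \<open>\<real>\<^sup>n\<close> is the subspace \<open>Rn n\<close> of sequences that vanish from index \<open>n\<close> on.
\<close>

typedef fseq = "{f :: nat \<Rightarrow> real. finite {i. f i \<noteq> 0}}"
  morphisms coord Abs_fseq
  by (rule exI[of _ "\<lambda>_. 0"]) simp

setup_lifting type_definition_fseq

lemma fseq_eqI: "(\<And>i. coord x i = coord y i) \<Longrightarrow> x = y"
  by (metis coord_inject ext)

lemma finite_coord: "finite {i. coord x i \<noteq> 0}"
  using coord[of x] by simp

instantiation fseq :: real_vector
begin

lift_definition zero_fseq :: fseq is "\<lambda>_. 0"
  by simp

lift_definition plus_fseq :: "fseq \<Rightarrow> fseq \<Rightarrow> fseq" is "\<lambda>f g i. f i + g i"
proof -
  fix f g :: "nat \<Rightarrow> real"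
  assume fin: "finite {i. f i \<noteq> 0}" "finite {i. g i \<noteq> 0}"
  show "finite {i. f i + g i \<noteq> 0}"
    by (rule finite_subset[of _ "{i. f i \<noteq> 0} \<union> {i. g i \<noteq> 0}"]) (use fin in auto)
qed

lift_definition uminus_fseq :: "fseq \<Rightarrow> fseq" is "\<lambda>f i. - f i"
  by simp

lift_definition minus_fseq :: "fseq \<Rightarrow> fseq \<Rightarrow> fseq" is "\<lambda>f g i. f i - g i"
proof -
  fix f g :: "nat \<Rightarrow> real"
  assume fin: "finite {i. f i \<noteq> 0}" "finite {i. g i \<noteq> 0}"
  show "finite {i. f i - g i \<noteq> 0}"
    by (rule finite_subset[of _ "{i. f i \<noteq> 0} \<union> {i. g i \<noteq> 0}"]) (use fin in auto)
qed

lift_definition scaleR_fseq :: "real \<Rightarrow> fseq \<Rightarrow> fseq" is "\<lambda>c f i. c * f i"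
  by (rule finite_subset[rotated]) auto

lemmas coord_simps [simp] =
  zero_fseq.rep_eq plus_fseq.rep_eq uminus_fseq.rep_eq minus_fseq.rep_eq scaleR_fseq.rep_eq

instance
proof
  fix x y z :: fseq and a b :: real
  show "x + y + z = x + (y + z)" "x + y = y + x" "0 + x = x" "- x + x = 0" "x - y = x + - y"
    by (rule fseq_eqI; simp)+
  show "a *\<^sub>R (x + y) = a *\<^sub>R x + a *\<^sub>R y" "(a + b) *\<^sub>R x = a *\<^sub>R x + b *\<^sub>R x"
    "a *\<^sub>R b *\<^sub>R x = (a * b) *\<^sub>R x" "1 *\<^sub>R x = x"
    by (rule fseq_eqI; simp add: distrib_left distrib_right)+
qed

end

instantiation fseq :: real_inner
begin

definition inner_fseq :: "fseq \<Rightarrow> fseq \<Rightarrow> real"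
  where "inner_fseq x y = (\<Sum>i | coord x i \<noteq> 0. coord x i * coord y i)"

definition norm_fseq :: "fseq \<Rightarrow> real"
  where "norm_fseq x = sqrt (inner x x)"

definition sgn_fseq :: "fseq \<Rightarrow> fseq"
  where "sgn_fseq x = inverse (norm x) *\<^sub>R x"

definition dist_fseq :: "fseq \<Rightarrow> fseq \<Rightarrow> real"
  where "dist_fseq x y = norm (x - y)"

definition uniformity_fseq :: "(fseq \<times> fseq) filter"
  where "uniformity_fseq = (INF e\<in>{0 <..}. principal {(x, y). dist x y < e})"

definition open_fseq :: "fseq set \<Rightarrow> bool"
  where "open_fseq U \<longleftrightarrow> (\<forall>x\<in>U. \<forall>\<^sub>F (x', y) in uniformity. x' = x \<longrightarrow> y \<in> U)"

lemma inner_fseq_eq_sum: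
  assumes "finite I" "{i. coord x i \<noteq> 0} \<subseteq> I"
  shows "inner x y = (\<Sum>i\<in>I. coord x i * coord y i)"
  unfolding inner_fseq_def by (rule sum.mono_neutral_left) (use assms in auto)

instance
proof
  fix x y z :: fseq and r :: real
  define I where "I = {i. coord x i \<noteq> 0} \<union> {i. coord y i \<noteq> 0}"
  have I: "finite I" "{i. coord x i \<noteq> 0} \<subseteq> I" "{i. coord y i \<noteq> 0} \<subseteq> I"
    "{i. coord (x + y) i \<noteq> 0} \<subseteq> I" "{i. coord (r *\<^sub>R x) i \<noteq> 0} \<subseteq> I"
    by (auto simp: I_def finite_coord)
  show "inner x y = inner y x"
    by (simp add: inner_fseq_eq_sum[OF I(1,2)] inner_fseq_eq_sum[OF I(1,3)] mult.commute)
  show "inner (x + y) z = inner x z + inner y z"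
    by (simp only: inner_fseq_eq_sum[OF I(1,2)] inner_fseq_eq_sum[OF I(1,3)]
        inner_fseq_eq_sum[OF I(1,4)]) (simp add: sum.distrib algebra_simps)
  show "inner (r *\<^sub>R x) y = r * inner x y"
    by (simp only: inner_fseq_eq_sum[OF I(1,2)] inner_fseq_eq_sum[OF I(1,5)])
      (simp add: sum_distrib_left algebra_simps)
  show "0 \<le> inner x x"
    by (simp add: inner_fseq_def sum_nonneg)
  show "inner x x = 0 \<longleftrightarrow> x = 0"
    by (auto simp: inner_fseq_def sum_nonneg_eq_0_iff finite_coord intro: fseq_eqI)
qed (simp_all only: norm_fseq_def sgn_fseq_def dist_fseq_def uniformity_fseq_def open_fseq_def)

end

definition Rn :: "nat \<Rightarrow> fseq set"
  where "Rn n = {x. \<forall>i\<ge>n. coord x i = 0}"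

text \<open>\<open>Rn n\<close> is a copy of the usual Euclidean space.\<close>

lemma subspace_Rn: "subspace (Rn n)"
  by (auto simp: subspace_def Rn_def)

lemma inner_Rn: "x \<in> Rn n \<Longrightarrow> inner x y = (\<Sum>i<n. coord x i * coord y i)"
  by (rule inner_fseq_eq_sum) (auto simp: Rn_def not_less[symmetric])

lemma norm_Rn: "x \<in> Rn n \<Longrightarrow> norm x = sqrt (\<Sum>i<n. (coord x i)\<^sup>2)"
  by (simp add: norm_eq_sqrt_inner inner_Rn power2_eq_square)

lemma bij_betw_coord_Rn: "bij_betw coord (Rn n) (topspace (Euclidean_space n))"
proof -
  have "f \<in> coord ` Rn n" if f: "\<forall>i\<ge>n. f i = 0" for f
  proof -
    have "{i. f i \<noteq> 0} \<subseteq> {..<n}"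
      using f by (auto simp: not_less[symmetric])
    then have "coord (Abs_fseq f) = f"
      by (intro Abs_fseq_inverse) (simp add: finite_subset)
    then show ?thesis
      using f by (intro image_eqI[of _ _ "Abs_fseq f"]) (simp_all add: Rn_def)
  qed
  then show ?thesis
    by (auto simp: bij_betw_def inj_on_def coord_inject topspace_Euclidean_space Rn_def)
qed

definition axis_fseq :: "nat \<Rightarrow> fseq"
  where "axis_fseq k = Abs_fseq (\<lambda>i. if i = k then 1 else 0)"

lemma coord_axis_fseq: "coord (axis_fseq k) i = (if i = k then 1 else 0)"
  unfolding axis_fseq_def by (subst Abs_fseq_inverse) auto

lemma coord_sum: "coord (sum f A) i = (\<Sum>a\<in>A. coord (f a) i)"
  by (induction A rule: infinite_finite_induct) simp_all

lemma dim_Rn: "dim (Rn n) = n"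
proof -
  let ?B = "axis_fseq ` {..<n}"
  have inj: "inj axis_fseq"
    by (rule injI) (metis coord_axis_fseq zero_neq_one)
  have card: "card ?B = n"
    using card_image[OF inj_on_subset[OF inj subset_UNIV]] by simp
  have sub: "?B \<subseteq> Rn n"
    by (auto simp: Rn_def coord_axis_fseq)
  have span: "Rn n \<subseteq> span ?B"
  proof
    fix x assume x: "x \<in> Rn n"
    have "coord x i = coord (\<Sum>k<n. coord x k *\<^sub>R axis_fseq k) i" for i
    proof -
      have "coord (\<Sum>k<n. coord x k *\<^sub>R axis_fseq k) i = (\<Sum>k<n. if k = i then coord x k else 0)"
        unfolding coord_sum by (intro sum.cong) (simp_all add: coord_axis_fseq)
      also have "\<dots> = coord x i"
        using x by (simp add: Rn_def)
      finally show ?thesis ..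
    qed
    then have "x = (\<Sum>k<n. coord x k *\<^sub>R axis_fseq k)"
      by (rule fseq_eqI)
    also have "\<dots> \<in> span ?B"
      by (intro span_sum span_scale span_base imageI)
    finally show "x \<in> span ?B" .
  qed
  have orth: "inner (axis_fseq k) (axis_fseq l) = 0" if "k \<noteq> l" for k l
    unfolding inner_fseq_def using that by (intro sum.neutral) (simp add: coord_axis_fseq)
  have "independent ?B"
  proof (rule pairwise_orthogonal_independent)
    show "pairwise orthogonal ?B"
      by (rule pairwise_imageI) (simp add: orthogonal_def orth)
    have "axis_fseq k \<noteq> 0" for k
      by (metis coord_axis_fseq zero_fseq.rep_eq zero_neq_one)
    then show "0 \<notin> ?B"
      by (metis imageE)
  qed
  from basis_card_eq_dim[OF sub span this] card show ?thesis
    by simp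
qed

definition ball_Rn :: "nat \<Rightarrow> fseq \<Rightarrow> real \<Rightarrow> fseq set"
  where "ball_Rn n c r = ball c r \<inter> Rn n"

definition bounded_domain :: "nat \<Rightarrow> fseq set \<Rightarrow> bool"
  where "bounded_domain n \<Omega> \<longleftrightarrow>
    openin (top_of_set (Rn n)) \<Omega> \<and> connected \<Omega> \<and> \<Omega> \<noteq> {} \<and> bounded \<Omega>"

text \<open>
  No boundedness of \<open>u\<close> is assumed, so suprema and infima are taken in the extended reals.
\<close>

definition inf_sup_average :: "nat \<Rightarrow> nat \<Rightarrow> real \<Rightarrow> (fseq \<Rightarrow> real) \<Rightarrow> fseq \<Rightarrow> ereal"
  where "inf_sup_average n j \<epsilon> u x =
    (INF S \<in> {S. subspace S \<and> S \<subseteq> Rn n \<and> dim S = j}.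
      SUP v \<in> {v \<in> S. norm v = 1}. ereal ((u (x + \<epsilon> *\<^sub>R v) + u (x - \<epsilon> *\<^sub>R v)) / 2))"

text \<open>
  In \<open>ereal\<close> a sum that contains \<open>\<infinity>\<close> is \<open>\<infinity>\<close> (also \<open>\<infinity> + (- \<infinity>) = \<infinity>\<close>) and one that contains
  \<open>- \<infinity>\<close> is never real.  The equation below therefore forces every occurring term to be finite.
\<close>

definition satisfies_DPP ::
    "nat \<Rightarrow> (nat \<Rightarrow> real) \<Rightarrow> fseq set \<Rightarrow> real \<Rightarrow> (fseq \<Rightarrow> real) \<Rightarrow> bool"
  where "satisfies_DPP n \<alpha> \<Omega> \<epsilon> u \<longleftrightarrow>
    (\<forall>x\<in>\<Omega>. ereal (u x) =
      (\<Sum>j | j \<in> {1..n} \<and> \<alpha> j \<noteq> 0. ereal (\<alpha> j) * inf_sup_average n j \<epsilon> u x))"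

definition sup_norm_on :: "fseq set \<Rightarrow> (fseq \<Rightarrow> real) \<Rightarrow> ereal"
  where "sup_norm_on B u = (SUP y\<in>B. ereal \<bar>u y\<bar>)"

end

theory Submission
  imports Defs
begin

text \<open>
  With \<open>\<phi>(h) = \<bar>h\<bar>\<^sup>\<delta> + 6 \<epsilon>\<^sup>\<delta>\<close> for \<open>h \<noteq> 0\<close> and \<open>\<phi>(0) = 0\<close>, and \<open>c\<close> the midpoint of the two given
  points, \<open>u x - u z\<close> is compared with \<open>L \<phi>(x - z) + \<kappa> (\<bar>x - c\<bar>\<^sup>2 + \<bar>z - c\<bar>\<^sup>2)\<close>; the quadratic part
  is at least \<open>2 sup \<bar>u\<bar>\<close> once \<open>x\<close> or \<open>z\<close> is at distance \<open>r/2\<close> from \<open>c\<close>.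

  Let \<open>m = min \<alpha>\<^sub>1 \<alpha>\<^sub>n\<close> and let \<open>A\<^sub>j\<close> be the \<open>j\<close>-th operator of the equation.  In \<open>u x - u z\<close> a portion
  \<open>m\<close> of \<open>A\<^sub>1 u(x)\<close> is paired with \<open>A\<^sub>n u(z)\<close>, where both directions are ours, and a portion \<open>m\<close> of
  \<open>A\<^sub>n u(x)\<close> with \<open>A\<^sub>1 u(z)\<close>, where both directions are adversarial; everything else is paired with
  itself, using equal directions, so that \<open>x - z\<close> does not change.  If \<open>\<bar>x - z\<bar> \<ge> 2 \<epsilon>\<close>, we move along
  \<open>x - z\<close> in opposite senses and gain \<open>2 \<delta> (1 - \<delta>) \<epsilon>\<^sup>2 \<bar>x - z\<bar> powr (\<delta> - 2)\<close> by concavity, whereas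
  the adversary gains at most \<open>\<delta> \<epsilon>\<^sup>2 \<bar>x - z\<bar> powr (\<delta> - 2)\<close>; the balance is favourable exactly for
  \<open>\<delta> < 1/2\<close>.  If \<open>0 < \<bar>x - z\<bar> < 2 \<epsilon>\<close>, we make the two points coincide on one of the two sides and
  collect the jump of \<open>\<phi>\<close> at \<open>0\<close>.
\<close>

section \<open>Concavity inequalities for real powers\<close>

text \<open>Division by \<open>z\<close> reduces the bound to the tangent at 1, where it is
  convexity of \<open>exp\<close> between \<open>ln (y / z)\<close> and 0.\<close>

lemma powr_le_tangent:
  fixes y z p :: real
  assumes "0 \<le> y" "0 < z" "0 < p" "p \<le> 1"
  shows "y powr p \<le> z powr p + p * z powr (p - 1) * (y - z)"
proof -
  have q: "(y / z) powr p \<le> 1 + p * (y / z - 1)"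
  proof (cases "y = 0")
    case False
    then have y: "y / z > 0" using assms by simp
    have "exp (p * ln (y / z)) \<le> p * exp (ln (y / z)) + (1 - p) * exp 0"
      using convex_onD[OF exp_convex, of p 0 "ln (y / z)"] assms by simp
    then show ?thesis using y False assms(2) by (simp add: powr_def algebra_simps)
  qed (use assms in auto)
  have "y powr p = z powr p * (y / z) powr p"
    using assms by (simp add: powr_divide)
  also have "\<dots> \<le> z powr p * (1 + p * (y / z - 1))"
    by (intro mult_left_mono q) simp
  also have "\<dots> = z powr p + p * z powr (p - 1) * (y - z)"
    using assms by (simp add: powr_diff field_simps)
  finally show ?thesis .
qed

text \<open>The even Taylor coefficients after the constant are nonpositive, and the quadratic one
  is exactly \<open>- p * (1 - p)\<close>. Accordingly the difference \<open>k\<close> of the two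
  sides and its derivative vanish at 0, and its second derivative is nonnegative.\<close>

lemma powr_symmetric_sum_le:
  fixes s p :: real
  assumes "0 \<le> s" "s \<le> 1" "0 < p" "p \<le> 1"
  shows "(1 + s) powr p + (1 - s) powr p \<le> 2 - p * (1 - p) * s\<^sup>2"
proof -
  define k' where "k' t = p * (1 - t) powr (p - 1) - p * (1 + t) powr (p - 1) - 2 * p * (1 - p) * t" for t
  define k where "k t = 2 - p * (1 - p) * t\<^sup>2 - (1 + t) powr p - (1 - t) powr p" for t
  have k'': "(k' has_real_derivative
      p * (1 - p) * ((1 - t) powr (p - 2) + (1 + t) powr (p - 2) - 2)) (at t)" if "0 \<le> t" "t < 1" for t
    unfolding k'_def using that
    by (auto intro!: derivative_eq_intros simp: algebra_simps)
  have "(1 - t) powr (p - 2) + (1 + t) powr (p - 2) \<ge> 2" if "0 \<le> t" "t < 1" for t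
  proof -
    \<comment> \<open>AM-GM: the product \<open>a * b\<close> is a negative power of
      \<open>1 - t\<^sup>2\<close>, hence at least 1.\<close>
    define a b where "a = (1 - t) powr ((p - 2) / 2)" and "b = (1 + t) powr ((p - 2) / 2)"
    have sq: "(1 - t) powr (p - 2) = a\<^sup>2" "(1 + t) powr (p - 2) = b\<^sup>2"
      using that by (auto simp: a_def b_def power2_eq_square simp flip: powr_add)
    have "a * b = (1 - t\<^sup>2) powr ((p - 2) / 2)"
      by (simp add: a_def b_def power2_eq_square algebra_simps flip: powr_mult)
    also have "\<dots> \<ge> 1 powr ((p - 2) / 2)"
      using that assms by (intro powr_mono2') (auto simp: abs_square_less_1)
    finally have "1 \<le> a * b" by simp
    then show ?thesis
      using sum_squares_bound[of a b] unfolding sq by simp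
  qed
  then have k'_deriv: "\<exists>y. (k' has_real_derivative y) (at t) \<and> 0 \<le> y" if "0 \<le> t" "t < 1" for t
    using k''[OF that] that assms
    by (intro exI[of _ "p * (1 - p) * ((1 - t) powr (p - 2) + (1 + t) powr (p - 2) - 2)"]) simp
  have k'_mono: "k' 0 \<le> k' t" if "0 \<le> t" "t < 1" for t
    by (rule DERIV_nonneg_imp_nondecreasing[where f = k']) (use that k'_deriv in auto)
  then have k'_nonneg: "0 \<le> k' t" if "0 \<le> t" "t < 1" for t
    using k'_mono[OF that] by (simp add: k'_def)
  have k': "(k has_real_derivative k' t) (at t)" if "0 \<le> t" "t < 1" for t
    unfolding k_def k'_def using that
    by (auto intro!: derivative_eq_intros simp: algebra_simps)
  have "k 0 \<le> k s" if "s < 1"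
  proof (rule DERIV_nonneg_imp_nondecreasing[where f = k])
    fix t assume "0 \<le> t" "t \<le> s"
    then show "\<exists>y. (k has_real_derivative y) (at t) \<and> 0 \<le> y"
      using k'[of t] k'_nonneg[of t] that by auto
  qed (use assms in simp)
  \<comment> \<open>The endpoint is separate because \<open>(1 - t) powr p\<close> need not be
    differentiable at 1; the tangent bound \<open>2 powr p \<le> 1 + p\<close> leaves
    \<open>(1 - p)\<^sup>2 \<ge> 0\<close>.\<close>
  moreover have "k 0 \<le> k 1"
    using powr_le_tangent[of 2 1 p] assms zero_le_power2[of "1 - p"]
    by (simp add: k_def power2_eq_square algebra_simps)
  ultimately have "k 0 \<le> k s"
    using assms by (cases "s = 1") auto
  then show ?thesis by (simp add: k_def)
qed

section \<open>Orthogonality and dimension in \<open>Rn n\<close>\<close>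

lemma inner_axis_fseq: "inner x (axis_fseq k) = coord x k"
proof -
  have "inner (axis_fseq k) x = coord x k"
    by (subst inner_fseq_eq_sum[of "{k}"]) (auto simp: coord_axis_fseq)
  then show ?thesis by (simp add: inner_commute)
qed

text \<open>The first two coordinates of \<open>h\<close> are rotated by a right angle and the
  others dropped; if \<open>coord h 0\<close> vanishes, \<open>axis_fseq 0\<close> already
  works.\<close>

lemma exists_unit_orthogonal_Rn:
  assumes "n \<ge> 2"
  obtains p where "p \<in> Rn n" "norm p = 1" "inner h p = 0"
proof -
  define q where "q = (if coord h 0 = 0 then axis_fseq 0
    else coord h 0 *\<^sub>R axis_fseq 1 - coord h 1 *\<^sub>R axis_fseq 0)"
  have q: "inner h q = 0"
    by (simp add: q_def inner_diff_right inner_axis_fseq)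
  have "coord q (if coord h 0 = 0 then 0 else 1) \<noteq> 0"
    by (simp add: q_def coord_axis_fseq)
  then have "q \<noteq> 0" by auto
  moreover have "q \<in> Rn n"
    using assms by (auto simp: q_def Rn_def coord_axis_fseq)
  ultimately show ?thesis
    using q by (intro that[of "q /\<^sub>R norm q"]) (auto intro: subspace_scale[OF subspace_Rn])
qed

lemma subspace_unit_vector:
  fixes S :: "fseq set"
  assumes "subspace S" "dim S \<ge> 1"
  obtains v where "v \<in> S" "norm v = 1"
proof -
  have "\<not> S \<subseteq> {0}"
  proof
    assume "S \<subseteq> {0}"
    then have "S = {} \<or> S = {0}" by auto
    moreover have "dim {0 :: fseq} = dim ({} :: fseq set)"
      using dim_span[of "{} :: fseq set"] by (simp only: span_empty)
    ultimately have "dim S = 0"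
      using dim_eq_card_independent[OF independent_empty] by auto
    then show False using assms(2) by simp
  qed
  then obtain x where "x \<in> S" "x \<noteq> 0" by blast
  then show ?thesis
    using assms(1) by (intro that[of "x /\<^sub>R norm x"]) (auto intro: subspace_scale)
qed

text \<open>A vector of \<open>Rn n\<close> outside \<open>S\<close> would enlarge a basis of
  \<open>S\<close> to \<open>n + 1\<close> independent vectors in the span of \<open>n\<close>
  vectors.\<close>

lemma full_dim_subspace_Rn:
  assumes "subspace S" "S \<subseteq> Rn n" "dim S = n"
  shows "S = Rn n"
proof (rule ccontr)
  assume "S \<noteq> Rn n"
  then obtain y where y: "y \<in> Rn n" "y \<notin> S" using assms(2) by blast
  obtain B where B: "B \<subseteq> S" "independent B" "S \<subseteq> span B" "card B = dim S"
    using basis_exists by blast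
  obtain T where T: "T \<subseteq> Rn n" "independent T" "Rn n \<subseteq> span T" "card T = n"
    using basis_exists[of "Rn n"] dim_Rn by metis
  have span_B: "span B \<subseteq> S"
    using B(1) assms(1) by (rule span_minimal)
  show False
  proof (cases "n = 0")
    case True
    then have "y = 0" using y(1) by (intro fseq_eqI) (simp add: Rn_def)
    then show ?thesis using y(2) assms(1) by (simp add: subspace_0)
  next
    case False
    then have "finite T" using T(4) by (metis card.infinite)
    moreover have "independent (insert y B)"
      using B(2) y(2) span_B by (intro independent_insertI) auto
    moreover have "insert y B \<subseteq> span T"
      using y(1) B(1) assms(2) T(3) by auto
    ultimately have "finite (insert y B)" "card (insert y B) \<le> n"
      using independent_span_bound[of T "insert y B"] T(4) by auto
    moreover have "y \<notin> B" using y(2) B(1) by auto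
    ultimately show False using B(4) assms(3) by simp
  qed
qed

section \<open>Bounds for the inf-sup operators\<close>

definition symmetric_average :: "real \<Rightarrow> (fseq \<Rightarrow> real) \<Rightarrow> fseq \<Rightarrow> fseq \<Rightarrow> real"
  where "symmetric_average \<epsilon> u x v = (u (x + \<epsilon> *\<^sub>R v) + u (x - \<epsilon> *\<^sub>R v)) / 2"

lemma inf_sup_average_eq:
  "inf_sup_average n j \<epsilon> u x = (INF S \<in> {S. subspace S \<and> S \<subseteq> Rn n \<and> dim S = j}.
      SUP v \<in> {v \<in> S. norm v = 1}. ereal (symmetric_average \<epsilon> u x v))"
  by (simp add: inf_sup_average_def symmetric_average_def)

lemma inf_sup_average_le:
  assumes "j \<le> n" "\<And>v. v \<in> Rn n \<Longrightarrow> norm v = 1 \<Longrightarrow> symmetric_average \<epsilon> u x v \<le> b"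
  shows "inf_sup_average n j \<epsilon> u x \<le> ereal b"
proof -
  have "Rn j \<subseteq> Rn n" using assms(1) by (auto simp: Rn_def)
  then show ?thesis
    unfolding inf_sup_average_eq using assms(2) subspace_Rn dim_Rn
    by (intro INF_lower2[of "Rn j"] SUP_least) auto
qed

lemma inf_sup_average_ge:
  assumes "1 \<le> j" "\<And>v. v \<in> Rn n \<Longrightarrow> norm v = 1 \<Longrightarrow> b \<le> symmetric_average \<epsilon> u x v"
  shows "ereal b \<le> inf_sup_average n j \<epsilon> u x"
  unfolding inf_sup_average_eq
proof (rule INF_greatest)
  fix S assume S: "S \<in> {S. subspace S \<and> S \<subseteq> Rn n \<and> dim S = j}"
  then obtain v where v: "v \<in> S" "norm v = 1"
    using subspace_unit_vector[of S] assms(1) by auto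
  with S assms(2)[of v] show "ereal b \<le> (SUP v \<in> {v \<in> S. norm v = 1}. ereal (symmetric_average \<epsilon> u x v))"
    by (intro SUP_upper2[of v]) auto
qed

text \<open>The unit vectors of \<open>span {w}\<close> are \<open>w\<close> and \<open>- w\<close>,
  and \<open>symmetric_average\<close> is even in the direction. This is what lets a direction be
  chosen when \<open>j = 1\<close>.\<close>

lemma inf_sup_average_1_le:
  assumes "w \<in> Rn n" "norm w = 1"
  shows "inf_sup_average n 1 \<epsilon> u x \<le> ereal (symmetric_average \<epsilon> u x w)"
  unfolding inf_sup_average_eq
proof (intro INF_lower2[of "span {w}"] SUP_least)
  have "w \<noteq> 0" using assms(2) by auto
  then have "dim {w} = 1" by (simp add: dim_eq_card_independent)
  then show "span {w} \<in> {S. subspace S \<and> S \<subseteq> Rn n \<and> dim S = 1}"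
    using assms by (auto intro: span_minimal[OF _ subspace_Rn, THEN subsetD])
next
  fix v assume "v \<in> {v \<in> span {w}. norm v = 1}"
  then obtain k where k: "v = k *\<^sub>R w" and "norm v = 1"
    unfolding span_singleton by blast
  then have "\<bar>k\<bar> = 1" using assms(2) by simp
  then have "v = w \<or> v = - w" using k by (auto simp: abs_if split: if_splits)
  then show "ereal (symmetric_average \<epsilon> u x v) \<le> ereal (symmetric_average \<epsilon> u x w)"
    by (auto simp: symmetric_average_def)
qed

text \<open>The infimum runs over \<open>Rn n\<close> alone, so only the supremum over all
  directions remains.\<close>

lemma inf_sup_average_n_ge:
  assumes "v \<in> Rn n" "norm v = 1"
  shows "ereal (symmetric_average \<epsilon> u x v) \<le> inf_sup_average n n \<epsilon> u x"
  unfolding inf_sup_average_eq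
  using assms full_dim_subspace_Rn by (intro INF_greatest SUP_upper2[of v]) auto

text \<open>The same subspace and the same direction are used at both points. Nothing is assumed
  finite, so the argument stays in \<open>ereal\<close>, where shifting by the real \<open>b\<close>
  is harmless.\<close>

lemma inf_sup_average_le_add:
  assumes "\<And>v. v \<in> Rn n \<Longrightarrow> norm v = 1 \<Longrightarrow>
      symmetric_average \<epsilon> u x v \<le> symmetric_average \<epsilon> u z v + b"
  shows "inf_sup_average n j \<epsilon> u x \<le> inf_sup_average n j \<epsilon> u z + ereal b"
proof -
  have "inf_sup_average n j \<epsilon> u x - ereal b \<le> inf_sup_average n j \<epsilon> u z"
    unfolding inf_sup_average_eq[of n j \<epsilon> u z]
  proof (rule INF_greatest)
    fix S assume S: "S \<in> {S. subspace S \<and> S \<subseteq> Rn n \<and> dim S = j}"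
    let ?SUP = "\<lambda>y. SUP v \<in> {v \<in> S. norm v = 1}. ereal (symmetric_average \<epsilon> u y v)"
    have "inf_sup_average n j \<epsilon> u x \<le> ?SUP x"
      unfolding inf_sup_average_eq by (rule INF_lower[OF S])
    also have "\<dots> \<le> ?SUP z + ereal b"
    proof (rule SUP_least)
      fix v assume v: "v \<in> {v \<in> S. norm v = 1}"
      then have "ereal (symmetric_average \<epsilon> u x v) \<le> ereal (symmetric_average \<epsilon> u z v) + ereal b"
        using assms[of v] S by auto
      also have "\<dots> \<le> ?SUP z + ereal b"
        by (intro add_right_mono SUP_upper v)
      finally show "ereal (symmetric_average \<epsilon> u x v) \<le> ?SUP z + ereal b" .
    qed
    finally show "inf_sup_average n j \<epsilon> u x - ereal b \<le> ?SUP z"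
      by (subst ereal_minus_le_iff) (auto simp: add.commute)
  qed
  then show ?thesis
    by (subst (asm) ereal_minus_le_iff) (auto simp: add.commute)
qed

lemma inf_sup_average_real:
  assumes "j \<in> {1..n}" "\<And>v. v \<in> Rn n \<Longrightarrow> norm v = 1 \<Longrightarrow> \<bar>symmetric_average \<epsilon> u x v\<bar> \<le> M"
  shows "ereal (real_of_ereal (inf_sup_average n j \<epsilon> u x)) = inf_sup_average n j \<epsilon> u x"
proof -
  have "inf_sup_average n j \<epsilon> u x \<le> ereal M" "ereal (- M) \<le> inf_sup_average n j \<epsilon> u x"
    using assms by (auto intro!: inf_sup_average_le inf_sup_average_ge simp: abs_le_iff minus_le_iff)
  then have "\<bar>inf_sup_average n j \<epsilon> u x\<bar> \<noteq> \<infinity>"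
    by auto
  then show ?thesis by (rule ereal_real')
qed

text \<open>\<open>R\<close> is the cost of pairing an operator with itself,
  \<open>R\<^sub>1\<close> that of pairing index 1 at \<open>x\<close> with index \<open>n\<close>
  at \<open>z\<close>, and \<open>R\<^sub>2\<close> that of the reverse pairing. Moving weight
  \<open>m\<close> from each of these two indices to the crossed pairings leaves
  \<open>1 - 2 * m\<close> for equal ones.\<close>

lemma satisfies_DPP_difference_le:
  assumes "n \<ge> 2" "satisfies_DPP n \<alpha> \<Omega> \<epsilon> u" "x \<in> \<Omega>" "z \<in> \<Omega>"
    and \<alpha>: "\<And>j. j \<in> {1..n} \<Longrightarrow> 0 \<le> \<alpha> j" "(\<Sum>j=1..n. \<alpha> j) = 1"
    and m: "0 \<le> m" "m \<le> \<alpha> 1" "m \<le> \<alpha> n"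
    and bounded: "\<And>v. v \<in> Rn n \<Longrightarrow> norm v = 1 \<Longrightarrow> \<bar>symmetric_average \<epsilon> u x v\<bar> \<le> M"
      "\<And>v. v \<in> Rn n \<Longrightarrow> norm v = 1 \<Longrightarrow> \<bar>symmetric_average \<epsilon> u z v\<bar> \<le> M"
    and R: "\<And>v. v \<in> Rn n \<Longrightarrow> norm v = 1 \<Longrightarrow>
      symmetric_average \<epsilon> u x v \<le> symmetric_average \<epsilon> u z v + R"
    and R1: "w\<^sub>0 \<in> Rn n" "norm w\<^sub>0 = 1" "v\<^sub>0 \<in> Rn n" "norm v\<^sub>0 = 1"
      "symmetric_average \<epsilon> u x w\<^sub>0 \<le> symmetric_average \<epsilon> u z v\<^sub>0 + R\<^sub>1"
    and R2: "\<And>w v. w \<in> Rn n \<Longrightarrow> norm w = 1 \<Longrightarrow> v \<in> Rn n \<Longrightarrow> norm v = 1 \<Longrightarrow>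
      symmetric_average \<epsilon> u x w \<le> symmetric_average \<epsilon> u z v + R\<^sub>2"
  shows "u x - u z \<le> (1 - 2 * m) * R + m * (R\<^sub>1 + R\<^sub>2)"
proof -
  \<comment> \<open>\<open>real_of_ereal\<close> sends infinite values to 0; boundedness of the
    averages excludes this at \<open>x\<close> and \<open>z\<close>.\<close>
  define A where "A j y = real_of_ereal (inf_sup_average n j \<epsilon> u y)" for j y
  have A: "inf_sup_average n j \<epsilon> u y = ereal (A j y)" if "j \<in> {1..n}" "y \<in> {x, z}" for j y
    using that inf_sup_average_real[of j n \<epsilon> u y M] bounded by (auto simp: A_def)
  have u: "u y = (\<Sum>j=1..n. \<alpha> j * A j y)" if "y \<in> {x, z}" for y
  proof -
    have "ereal (u y) = (\<Sum>j | j \<in> {1..n} \<and> \<alpha> j \<noteq> 0. ereal (\<alpha> j) * inf_sup_average n j \<epsilon> u y)"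
      using assms(2-4) that by (auto simp: satisfies_DPP_def)
    also have "\<dots> = (\<Sum>j | j \<in> {1..n} \<and> \<alpha> j \<noteq> 0. ereal (\<alpha> j * A j y))"
      using A[OF _ that] by (intro sum.cong) auto
    also have "\<dots> = ereal (\<Sum>j | j \<in> {1..n} \<and> \<alpha> j \<noteq> 0. \<alpha> j * A j y)"
      by simp
    also have "(\<Sum>j | j \<in> {1..n} \<and> \<alpha> j \<noteq> 0. \<alpha> j * A j y) = (\<Sum>j=1..n. \<alpha> j * A j y)"
      by (rule sum.mono_neutral_left) auto
    finally show ?thesis by simp
  qed
  have A_le: "A j x - A j z \<le> R" if "j \<in> {1..n}" for j
    using inf_sup_average_le_add[of n \<epsilon> u x z R j] R A[OF that] by simp
  have A1: "A 1 x \<le> symmetric_average \<epsilon> u x w" if "w \<in> Rn n" "norm w = 1" for w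
    using inf_sup_average_1_le[OF that, of \<epsilon> u x] A[of 1 x] assms(1) by simp
  have An: "symmetric_average \<epsilon> u z v \<le> A n z" if "v \<in> Rn n" "norm v = 1" for v
    using inf_sup_average_n_ge[OF that, of \<epsilon> u z] A[of n z] assms(1) by simp
  \<comment> \<open>For fixed \<open>v\<close> the bound is uniform in \<open>w\<close> and passes
    to \<open>A n x\<close>; it is then uniform in \<open>v\<close> and passes to
    \<open>A 1 z\<close>.\<close>
  have "A n x \<le> A 1 z + R\<^sub>2"
  proof -
    have "A n x - R\<^sub>2 \<le> symmetric_average \<epsilon> u z v" if "v \<in> Rn n" "norm v = 1" for v
      using inf_sup_average_le[of n n \<epsilon> u x "symmetric_average \<epsilon> u z v + R\<^sub>2"] R2 that
        A[of n x] assms(1) by simp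
    then show ?thesis
      using inf_sup_average_ge[of 1 n "A n x - R\<^sub>2" \<epsilon> u z] A[of 1 z] assms(1) by simp
  qed
  moreover have "A 1 x \<le> A n z + R\<^sub>1"
    using A1[OF R1(1,2)] An[OF R1(3,4)] R1(5) by linarith
  ultimately have D: "(A 1 x - A 1 z) + (A n x - A n z) \<le> R\<^sub>1 + R\<^sub>2"
    by linarith
  \<comment> \<open>The indices 1 and \<open>n\<close> are distinct as \<open>n \<ge> 2\<close>, so
    exactly \<open>2 * m\<close> is removed in total.\<close>
  define \<beta> where "\<beta> j = \<alpha> j - (if j = 1 \<or> j = n then m else 0)" for j
  have split: "(\<Sum>j=1..n. \<alpha> j * f j) = (\<Sum>j=1..n. \<beta> j * f j) + m * (f 1 + f n)" for f :: "nat \<Rightarrow> real"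
  proof -
    have "(\<Sum>j=1..n. (if j = 1 \<or> j = n then m else 0) * f j) = (\<Sum>j\<in>{1, n}. m * f j)"
      using assms(1) by (intro sum.mono_neutral_cong_right) auto
    also have "\<dots> = m * (f 1 + f n)"
      using assms(1) by (simp add: distrib_left)
    finally show ?thesis
      by (simp add: \<beta>_def left_diff_distrib sum_subtractf)
  qed
  have "u x - u z = (\<Sum>j=1..n. \<alpha> j * (A j x - A j z))"
    by (simp add: u right_diff_distrib sum_subtractf)
  also have "\<dots> = (\<Sum>j=1..n. \<beta> j * (A j x - A j z)) + m * ((A 1 x - A 1 z) + (A n x - A n z))"
    by (rule split)
  also have "\<dots> \<le> (\<Sum>j=1..n. \<beta> j * R) + m * (R\<^sub>1 + R\<^sub>2)"
    using \<alpha>(1) m A_le by (intro add_mono sum_mono mult_left_mono D) (auto simp: \<beta>_def)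
  also have "(\<Sum>j=1..n. \<beta> j * R) = (1 - 2 * m) * R"
    using split[of "\<lambda>_. 1"] \<alpha>(2) by (simp flip: sum_distrib_right)
  finally show ?thesis .
qed

section \<open>The comparison function and the choice of directions\<close>

text \<open>The factor 6 is the least for which the estimates below close: with jump
  \<open>K * \<epsilon> powr \<delta>\<close> and \<open>norm h < 2 * \<epsilon>\<close> they need
  \<open>6 * K + 8 \<le> 8 * K - 4\<close>.\<close>

definition jump_powr :: "real \<Rightarrow> real \<Rightarrow> fseq \<Rightarrow> real"
  where "jump_powr \<delta> \<epsilon> h = (if h = 0 then 0 else norm h powr \<delta> + 6 * \<epsilon> powr \<delta>)"

lemma jump_powr_le: "jump_powr \<delta> \<epsilon> h \<le> norm h powr \<delta> + 6 * \<epsilon> powr \<delta>"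
  by (simp add: jump_powr_def)

lemma jump_powr_nonneg: "0 \<le> jump_powr \<delta> \<epsilon> h"
  by (simp add: jump_powr_def)

text \<open>Tangent bound for the power \<open>\<delta> / 2\<close> of the squared norms at
  \<open>(norm h)\<^sup>2\<close>; summed over the signs of \<open>w\<close> and \<open>v\<close>,
  all inner products cancel. For the pair with \<open>w - v\<close> alone this bound can be twice as
  large as on average, which would exceed the concavity gain for every positive
  \<open>\<delta>\<close>.\<close>

lemma sum_signs_norm_powr_le:
  fixes h w v :: "'a::real_inner"
  assumes "h \<noteq> 0" "norm w = \<epsilon>" "norm v = \<epsilon>" "0 < \<delta>" "\<delta> \<le> 2"
  shows "norm (h + (w - v)) powr \<delta> + norm (h - (w - v)) powr \<delta>
      + norm (h + (w + v)) powr \<delta> + norm (h - (w + v)) powr \<delta>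
    \<le> 4 * (norm h powr \<delta> + \<delta> * \<epsilon>\<^sup>2 * norm h powr (\<delta> - 2))"
proof -
  have square_powr: "(a\<^sup>2) powr p = a powr (2 * p)" if "0 \<le> a" for a p :: real
    using that powr_powr[of a 2 p] by (cases "a = 0") (auto simp: powr_numeral)
  have "norm k powr \<delta> \<le> norm h powr \<delta> + \<delta> / 2 * norm h powr (\<delta> - 2) * ((norm k)\<^sup>2 - (norm h)\<^sup>2)"
    for k :: 'a
    using powr_le_tangent[of "(norm k)\<^sup>2" "(norm h)\<^sup>2" "\<delta> / 2"] assms
    by (simp add: square_powr algebra_simps)
  then have "norm (h + (w - v)) powr \<delta> + norm (h - (w - v)) powr \<delta>
      + norm (h + (w + v)) powr \<delta> + norm (h - (w + v)) powr \<delta>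
    \<le> 4 * norm h powr \<delta> + \<delta> / 2 * norm h powr (\<delta> - 2) *
      ((norm (h + (w - v)))\<^sup>2 + (norm (h - (w - v)))\<^sup>2 + (norm (h + (w + v)))\<^sup>2 + (norm (h - (w + v)))\<^sup>2
        - 4 * (norm h)\<^sup>2)" (is "?L \<le> _ + ?c * ?Q")
    by (smt (verit, ccfv_SIG) distrib_left)
  also have "?Q = 4 * ((norm w)\<^sup>2 + (norm v)\<^sup>2)"
    by (simp add: power2_norm_eq_inner inner_simps inner_commute)
  finally show ?thesis
    using assms(2,3) by (simp add: algebra_simps)
qed

text \<open>The two terms with the fixed directions \<open>w\<^sub>0\<close>, \<open>v\<^sub>0\<close> enter with twice the weight of the four
  terms with arbitrary directions, since the latter are averaged over the sign of \<open>v\<close>.\<close>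

lemma jump_powr_directions:
  assumes "n \<ge> 2" "h \<in> Rn n" "h \<noteq> 0" "norm h \<le> r" "0 < \<epsilon>" "\<epsilon> \<le> r" "0 < \<delta>" "\<delta> < 1/2"
  obtains w\<^sub>0 v\<^sub>0 where "w\<^sub>0 \<in> Rn n" "norm w\<^sub>0 = 1" "v\<^sub>0 \<in> Rn n" "norm v\<^sub>0 = 1"
    and "\<And>w v. norm w = 1 \<Longrightarrow> norm v = 1 \<Longrightarrow>
      2 * (jump_powr \<delta> \<epsilon> (h + \<epsilon> *\<^sub>R (w\<^sub>0 - v\<^sub>0)) + jump_powr \<delta> \<epsilon> (h - \<epsilon> *\<^sub>R (w\<^sub>0 - v\<^sub>0)))
      + (jump_powr \<delta> \<epsilon> (h + \<epsilon> *\<^sub>R (w - v)) + jump_powr \<delta> \<epsilon> (h - \<epsilon> *\<^sub>R (w - v))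
        + jump_powr \<delta> \<epsilon> (h + \<epsilon> *\<^sub>R (w + v)) + jump_powr \<delta> \<epsilon> (h - \<epsilon> *\<^sub>R (w + v)))
      \<le> 8 * jump_powr \<delta> \<epsilon> h - 4 * (\<delta> * (1 - 2 * \<delta>) * \<epsilon>\<^sup>2 * r powr (\<delta> - 2))"
proof (cases "2 * \<epsilon> \<le> norm h")
  case True
  define d where "d = norm h"
  define e where "e = h /\<^sub>R d"
  define s where "s = 2 * \<epsilon> / d"
  have d: "0 < d" "2 * \<epsilon> \<le> d" "d \<le> r" using assms True by (auto simp: d_def)
  have s: "0 \<le> s" "s \<le> 1" using d assms by (auto simp: s_def)
  have e: "e \<in> Rn n" "norm e = 1"
    using assms d by (auto simp: e_def d_def intro: subspace_scale[OF subspace_Rn])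
  \<comment> \<open>Opposite moves along \<open>h\<close> only rescale it by \<open>1 + s\<close>
    and \<open>1 - s\<close>, so the one-dimensional inequality applies.\<close>
  have eq: "h + \<epsilon> *\<^sub>R (e - - e) = (1 + s) *\<^sub>R h" "h - \<epsilon> *\<^sub>R (e - - e) = (1 - s) *\<^sub>R h"
    using d by (auto simp: e_def s_def divide_inverse algebra_simps simp flip: scaleR_2)
  have "norm ((1 + s) *\<^sub>R h) powr \<delta> + norm ((1 - s) *\<^sub>R h) powr \<delta>
      = d powr \<delta> * ((1 + s) powr \<delta> + (1 - s) powr \<delta>)"
    using s by (simp only: norm_scaleR powr_mult) (simp add: d_def algebra_simps)
  also have "\<dots> \<le> d powr \<delta> * (2 - \<delta> * (1 - \<delta>) * s\<^sup>2)"
    using s assms by (intro mult_left_mono powr_symmetric_sum_le) auto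
  also have "\<dots> = 2 * d powr \<delta> - 4 * \<delta> * (1 - \<delta>) * \<epsilon>\<^sup>2 * d powr (\<delta> - 2)"
    using d by (simp add: s_def powr_diff field_simps power2_eq_square)
  finally have good: "norm (h + \<epsilon> *\<^sub>R (e - - e)) powr \<delta> + norm (h - \<epsilon> *\<^sub>R (e - - e)) powr \<delta>
      \<le> 2 * d powr \<delta> - 4 * \<delta> * (1 - \<delta>) * \<epsilon>\<^sup>2 * d powr (\<delta> - 2)"
    unfolding eq .
  show ?thesis
  proof (rule that[of e "- e"])
    fix w v :: fseq assume "norm w = 1" "norm v = 1"
    then have bad: "norm (h + \<epsilon> *\<^sub>R (w - v)) powr \<delta> + norm (h - \<epsilon> *\<^sub>R (w - v)) powr \<delta>
      + norm (h + \<epsilon> *\<^sub>R (w + v)) powr \<delta> + norm (h - \<epsilon> *\<^sub>R (w + v)) powr \<delta>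
      \<le> 4 * (d powr \<delta> + \<delta> * \<epsilon>\<^sup>2 * d powr (\<delta> - 2))"
      using sum_signs_norm_powr_le[of h "\<epsilon> *\<^sub>R w" \<epsilon> "\<epsilon> *\<^sub>R v" \<delta>] assms
      by (simp add: d_def scaleR_diff_right scaleR_add_right)
    have "r powr (\<delta> - 2) \<le> d powr (\<delta> - 2)"
      using d assms by (intro powr_mono2') auto
    then have "\<delta> * (1 - 2 * \<delta>) * \<epsilon>\<^sup>2 * r powr (\<delta> - 2) \<le> \<delta> * (1 - 2 * \<delta>) * \<epsilon>\<^sup>2 * d powr (\<delta> - 2)"
      using assms by (intro mult_left_mono) auto
    moreover have "jump_powr \<delta> \<epsilon> h = d powr \<delta> + 6 * \<epsilon> powr \<delta>"
      using assms by (simp add: jump_powr_def d_def)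
    moreover note jump_powr_le[of \<delta> \<epsilon> "h + \<epsilon> *\<^sub>R (e - - e)"] jump_powr_le[of \<delta> \<epsilon> "h - \<epsilon> *\<^sub>R (e - - e)"]
      jump_powr_le[of \<delta> \<epsilon> "h + \<epsilon> *\<^sub>R (w - v)"] jump_powr_le[of \<delta> \<epsilon> "h - \<epsilon> *\<^sub>R (w - v)"]
      jump_powr_le[of \<delta> \<epsilon> "h + \<epsilon> *\<^sub>R (w + v)"] jump_powr_le[of \<delta> \<epsilon> "h - \<epsilon> *\<^sub>R (w + v)"]
    moreover have "2 * (2 * d powr \<delta> - 4 * \<delta> * (1 - \<delta>) * \<epsilon>\<^sup>2 * d powr (\<delta> - 2))
        + 4 * (d powr \<delta> + \<delta> * \<epsilon>\<^sup>2 * d powr (\<delta> - 2))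
      = 8 * d powr \<delta> - 4 * (\<delta> * (1 - 2 * \<delta>) * \<epsilon>\<^sup>2 * d powr (\<delta> - 2))"
      by (simp add: algebra_simps)
    ultimately show "2 * (jump_powr \<delta> \<epsilon> (h + \<epsilon> *\<^sub>R (e - - e)) + jump_powr \<delta> \<epsilon> (h - \<epsilon> *\<^sub>R (e - - e)))
      + (jump_powr \<delta> \<epsilon> (h + \<epsilon> *\<^sub>R (w - v)) + jump_powr \<delta> \<epsilon> (h - \<epsilon> *\<^sub>R (w - v))
        + jump_powr \<delta> \<epsilon> (h + \<epsilon> *\<^sub>R (w + v)) + jump_powr \<delta> \<epsilon> (h - \<epsilon> *\<^sub>R (w + v)))
      \<le> 8 * jump_powr \<delta> \<epsilon> h - 4 * (\<delta> * (1 - 2 * \<delta>) * \<epsilon>\<^sup>2 * r powr (\<delta> - 2))"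
      using good bad by argo
  qed (use e in \<open>auto intro: subspace_neg[OF subspace_Rn]\<close>)
next
  case False
  obtain p where p: "p \<in> Rn n" "norm p = 1" "inner h p = 0"
    using exists_unit_orthogonal_Rn[OF assms(1)] by blast
  \<comment> \<open>\<open>b\<close> is orthogonal to \<open>h\<close> and makes
    \<open>b - a\<close> and \<open>b + a\<close> unit vectors. Their difference is such that the
    two points meet on one side, while on the other \<open>h\<close> is doubled.\<close>
  define a where "a = h /\<^sub>R (2 * \<epsilon>)"
  define b where "b = sqrt (1 - (norm a)\<^sup>2) *\<^sub>R p"
  have ab: "a \<in> Rn n" "b \<in> Rn n"
    using assms(2) p by (auto simp: a_def b_def intro: subspace_scale[OF subspace_Rn])
  have "norm a \<le> 1"
    using False assms by (simp add: a_def field_simps)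
  then have "(norm a)\<^sup>2 \<le> 1" by (simp add: power_le_one)
  then have norm_b: "(norm b)\<^sup>2 = 1 - (norm a)\<^sup>2"
    using p by (simp add: b_def power_mult_distrib)
  have inner_ab: "inner a b = 0"
    using p by (simp add: a_def b_def)
  have "(norm (b - a))\<^sup>2 = 1" "(norm (b + a))\<^sup>2 = 1"
    using norm_b inner_ab by (simp_all add: power2_norm_eq_inner inner_simps inner_commute)
  then have norms: "norm (b - a) = 1" "norm (b + a) = 1"
    by (simp_all add: power2_eq_1_iff) (smt (verit) norm_ge_zero)+
  have "(b - a) - (b + a) = (- 2) *\<^sub>R a"
    by (simp add: scaleR_2)
  then have "\<epsilon> *\<^sub>R ((b - a) - (b + a)) = - h"
    using assms(5) by (simp add: a_def)
  then have eq: "h + \<epsilon> *\<^sub>R ((b - a) - (b + a)) = 0" "h - \<epsilon> *\<^sub>R ((b - a) - (b + a)) = 2 *\<^sub>R h"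
    by (simp_all add: scaleR_2)
  have two: "2 powr \<delta> \<le> 2"
    using powr_mono[of \<delta> 1 2] assms by simp
  \<comment> \<open>Here \<open>\<delta> < 1/2\<close> enters the close regime: a displacement of
    length at most \<open>4 * \<epsilon>\<close> has power at most
    \<open>2 * \<epsilon> powr \<delta>\<close>.\<close>
  have four: "4 powr \<delta> \<le> 2"
    using powr_mono[of \<delta> "1/2" 4] assms by (simp add: powr_half_sqrt)
  have good: "jump_powr \<delta> \<epsilon> (h + \<epsilon> *\<^sub>R ((b - a) - (b + a)))
      + jump_powr \<delta> \<epsilon> (h - \<epsilon> *\<^sub>R ((b - a) - (b + a))) \<le> 2 * norm h powr \<delta> + 6 * \<epsilon> powr \<delta>"
    unfolding eq using mult_right_mono[OF two, of "norm h powr \<delta>"] assms(3)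
    by (simp add: jump_powr_def powr_mult)
  have bad: "jump_powr \<delta> \<epsilon> (h + k) \<le> 8 * \<epsilon> powr \<delta>" if "norm k \<le> 2 * \<epsilon>" for k
  proof -
    have "norm (h + k) \<le> 4 * \<epsilon>"
      using norm_triangle_ineq[of h k] that False by simp
    then have "norm (h + k) powr \<delta> \<le> (4 * \<epsilon>) powr \<delta>"
      using assms by (intro powr_mono2) auto
    also have "\<dots> \<le> 2 * \<epsilon> powr \<delta>"
      using four assms by (simp add: powr_mult mult_right_mono)
    finally show ?thesis using jump_powr_le[of \<delta> \<epsilon> "h + k"] by simp
  qed
  show ?thesis
  proof (rule that[of "b - a" "b + a"])
    fix w v :: fseq assume wv: "norm w = 1" "norm v = 1"
    have "norm (\<epsilon> *\<^sub>R (w - v)) \<le> 2 * \<epsilon>" "norm (\<epsilon> *\<^sub>R (w + v)) \<le> 2 * \<epsilon>"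
      using norm_triangle_ineq4[of w v] norm_triangle_ineq[of w v] wv assms(5)
      by (simp_all add: mult.commute)
    then have "jump_powr \<delta> \<epsilon> (h + \<epsilon> *\<^sub>R (w - v)) \<le> 8 * \<epsilon> powr \<delta>"
      "jump_powr \<delta> \<epsilon> (h - \<epsilon> *\<^sub>R (w - v)) \<le> 8 * \<epsilon> powr \<delta>"
      "jump_powr \<delta> \<epsilon> (h + \<epsilon> *\<^sub>R (w + v)) \<le> 8 * \<epsilon> powr \<delta>"
      "jump_powr \<delta> \<epsilon> (h - \<epsilon> *\<^sub>R (w + v)) \<le> 8 * \<epsilon> powr \<delta>"
      using bad[of "\<epsilon> *\<^sub>R (w - v)"] bad[of "- (\<epsilon> *\<^sub>R (w - v))"]
        bad[of "\<epsilon> *\<^sub>R (w + v)"] bad[of "- (\<epsilon> *\<^sub>R (w + v))"] by simp_all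
    \<comment> \<open>The gain has the form dictated by the far regime; it is at most
      \<open>\<epsilon> powr \<delta>\<close> because \<open>\<epsilon> \<le> r\<close>. The jumps
      leave \<open>48 - 12 - 32 = 4\<close> such units, enough to pay for it four times.\<close>
    moreover have "\<delta> * (1 - 2 * \<delta>) * \<epsilon>\<^sup>2 * r powr (\<delta> - 2) \<le> \<epsilon> powr \<delta>"
    proof -
      have "\<delta> * (1 - 2 * \<delta>) \<le> 1"
        using assms by (intro mult_le_one) auto
      moreover have "r powr (\<delta> - 2) \<le> \<epsilon> powr (\<delta> - 2)"
        using assms by (intro powr_mono2') auto
      ultimately have "\<delta> * (1 - 2 * \<delta>) * (\<epsilon>\<^sup>2 * r powr (\<delta> - 2)) \<le> 1 * (\<epsilon>\<^sup>2 * \<epsilon> powr (\<delta> - 2))"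
        using assms by (intro mult_mono mult_left_mono) auto
      also have "\<dots> = \<epsilon> powr \<delta>"
        using assms by (simp add: powr_diff field_simps)
      finally show ?thesis by (simp add: mult.assoc)
    qed
    moreover have "jump_powr \<delta> \<epsilon> h = norm h powr \<delta> + 6 * \<epsilon> powr \<delta>"
      using assms by (simp add: jump_powr_def)
    moreover have "0 \<le> norm h powr \<delta>" by simp
    ultimately show "2 * (jump_powr \<delta> \<epsilon> (h + \<epsilon> *\<^sub>R ((b - a) - (b + a))) + jump_powr \<delta> \<epsilon> (h - \<epsilon> *\<^sub>R ((b - a) - (b + a))))
      + (jump_powr \<delta> \<epsilon> (h + \<epsilon> *\<^sub>R (w - v)) + jump_powr \<delta> \<epsilon> (h - \<epsilon> *\<^sub>R (w - v))
        + jump_powr \<delta> \<epsilon> (h + \<epsilon> *\<^sub>R (w + v)) + jump_powr \<delta> \<epsilon> (h - \<epsilon> *\<^sub>R (w + v)))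
      \<le> 8 * jump_powr \<delta> \<epsilon> h - 4 * (\<delta> * (1 - 2 * \<delta>) * \<epsilon>\<^sup>2 * r powr (\<delta> - 2))"
      using good by argo
  qed (use ab norms in \<open>auto intro: subspace_add[OF subspace_Rn] subspace_diff[OF subspace_Rn]\<close>)
qed

section \<open>Comparison by iteration\<close>

text \<open>Points with equal signs are matched. By the parallelogram law the quadratic part grows
  by a fixed amount whatever the directions, so only \<open>\<phi>\<close> feels their
  choice.\<close>

lemma symmetric_average_le_coupling:
  fixes \<phi> :: "fseq \<Rightarrow> real"
  assumes u_le: "\<And>x' z'. x' \<in> ball_Rn n c r \<Longrightarrow> z' \<in> ball_Rn n c r \<Longrightarrow>
      u x' - u z' \<le> L * \<phi> (x' - z') + \<kappa> * ((norm (x' - c))\<^sup>2 + (norm (z' - c))\<^sup>2) + \<theta>"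
    and ball: "\<And>v. v \<in> Rn n \<Longrightarrow> norm v = 1 \<Longrightarrow> x + \<epsilon> *\<^sub>R v \<in> ball_Rn n c r \<and> x - \<epsilon> *\<^sub>R v \<in> ball_Rn n c r"
      "\<And>v. v \<in> Rn n \<Longrightarrow> norm v = 1 \<Longrightarrow> z + \<epsilon> *\<^sub>R v \<in> ball_Rn n c r \<and> z - \<epsilon> *\<^sub>R v \<in> ball_Rn n c r"
    and w: "w \<in> Rn n" "norm w = 1" and v: "v \<in> Rn n" "norm v = 1"
  shows "symmetric_average \<epsilon> u x w \<le> symmetric_average \<epsilon> u z v +
    (L / 2 * (\<phi> (x - z + \<epsilon> *\<^sub>R (w - v)) + \<phi> (x - z - \<epsilon> *\<^sub>R (w - v)))
      + (\<kappa> * ((norm (x - c))\<^sup>2 + (norm (z - c))\<^sup>2 + 2 * \<epsilon>\<^sup>2) + \<theta>))"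
proof -
  have sq: "(norm (y + \<epsilon> *\<^sub>R k - c))\<^sup>2 + (norm (y - \<epsilon> *\<^sub>R k - c))\<^sup>2 = 2 * (norm (y - c))\<^sup>2 + 2 * \<epsilon>\<^sup>2"
    if "norm k = 1" for y k :: fseq
    using that by (simp add: power2_norm_eq_inner inner_simps inner_commute norm_eq_1 flip: power2_eq_square)
  have diff: "x + \<epsilon> *\<^sub>R w - (z + \<epsilon> *\<^sub>R v) = x - z + \<epsilon> *\<^sub>R (w - v)"
    "x - \<epsilon> *\<^sub>R w - (z - \<epsilon> *\<^sub>R v) = x - z - \<epsilon> *\<^sub>R (w - v)"
    by (simp_all add: algebra_simps)
  have "(u (x + \<epsilon> *\<^sub>R w) - u (z + \<epsilon> *\<^sub>R v)) + (u (x - \<epsilon> *\<^sub>R w) - u (z - \<epsilon> *\<^sub>R v))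
    \<le> L * (\<phi> (x - z + \<epsilon> *\<^sub>R (w - v)) + \<phi> (x - z - \<epsilon> *\<^sub>R (w - v)))
      + \<kappa> * ((norm (x + \<epsilon> *\<^sub>R w - c))\<^sup>2 + (norm (x - \<epsilon> *\<^sub>R w - c))\<^sup>2
        + ((norm (z + \<epsilon> *\<^sub>R v - c))\<^sup>2 + (norm (z - \<epsilon> *\<^sub>R v - c))\<^sup>2)) + 2 * \<theta>"
    using u_le[of "x + \<epsilon> *\<^sub>R w" "z + \<epsilon> *\<^sub>R v"] u_le[of "x - \<epsilon> *\<^sub>R w" "z - \<epsilon> *\<^sub>R v"] ball w v
    unfolding diff by (simp add: distrib_left)
  then show ?thesis
    unfolding sq[OF w(2)] sq[OF v(2)] by (simp add: symmetric_average_def field_simps)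
qed

text \<open>\<open>u\<close> need not be continuous, so \<open>u x - u z - G x z\<close> need not
  have a maximum at which the equation could be tested. Instead, each use of the equation lowers the
  error \<open>\<theta>\<close> by a fixed amount.\<close>

lemma comparison_improvement:
  assumes "n \<ge> 2" "satisfies_DPP n \<alpha> \<Omega> \<epsilon> u" "ball_Rn n c r \<subseteq> \<Omega>"
    and \<alpha>: "\<And>j. j \<in> {1..n} \<Longrightarrow> 0 \<le> \<alpha> j" "(\<Sum>j=1..n. \<alpha> j) = 1"
    and m: "0 < m" "m \<le> \<alpha> 1" "m \<le> \<alpha> n"
    and \<delta>: "0 < \<delta>" "\<delta> < 1/2" and \<epsilon>: "0 < \<epsilon>" "2 * \<epsilon> \<le> r"
    and bounded: "\<And>y. y \<in> ball_Rn n c r \<Longrightarrow> \<bar>u y\<bar> \<le> M" and "0 < M"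
    and L: "L = 17 * M / (m * \<delta> * (1 - 2 * \<delta>)) * r powr (- \<delta>)"
    and \<kappa>: "\<kappa> = 8 * M / r\<^sup>2"
    and G: "\<And>x z. G x z = L * jump_powr \<delta> \<epsilon> (x - z) + \<kappa> * ((norm (x - c))\<^sup>2 + (norm (z - c))\<^sup>2)"
    and u_le: "\<And>x z. x \<in> ball_Rn n c r \<Longrightarrow> z \<in> ball_Rn n c r \<Longrightarrow> u x - u z \<le> G x z + \<theta>"
    and x: "x \<in> ball_Rn n c r" and z: "z \<in> ball_Rn n c r"
  shows "u x - u z \<le> G x z + max 0 (\<theta> - M * \<epsilon>\<^sup>2 / r\<^sup>2)"
proof -
  have r: "0 < r" using \<epsilon> by simp
  have L0: "0 < L" using m \<delta> r \<open>0 < M\<close> by (simp add: L)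
  have \<kappa>0: "0 < \<kappa>" using r \<open>0 < M\<close> by (simp add: \<kappa>)
  \<comment> \<open>This fixes the 8 in \<open>\<kappa>\<close>: \<open>G\<close> dominates the
    trivial bound \<open>2 * M\<close> unless both points are so central that a step of length
    \<open>\<epsilon>\<close> stays in the ball.\<close>
  have far: "2 * M \<le> G x z" if "r / 2 \<le> norm (x - c) \<or> r / 2 \<le> norm (z - c)"
  proof -
    have "(r / 2)\<^sup>2 \<le> (norm (x - c))\<^sup>2 \<or> (r / 2)\<^sup>2 \<le> (norm (z - c))\<^sup>2"
      using that r by (auto intro: power_mono)
    then have "(r / 2)\<^sup>2 \<le> (norm (x - c))\<^sup>2 + (norm (z - c))\<^sup>2"
      by (smt (verit) zero_le_power2)
    then have "\<kappa> * (r / 2)\<^sup>2 \<le> \<kappa> * ((norm (x - c))\<^sup>2 + (norm (z - c))\<^sup>2)"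
      using \<kappa>0 by (intro mult_left_mono) auto
    moreover have "\<kappa> * (r / 2)\<^sup>2 = 2 * M"
      using r by (simp add: \<kappa> power_divide)
    moreover have "0 \<le> L * jump_powr \<delta> \<epsilon> (x - z)"
      using L0 jump_powr_nonneg[of \<delta> \<epsilon> "x - z"] by simp
    ultimately show ?thesis unfolding G by linarith
  qed
  have "0 \<le> G x z"
    unfolding G using L0 \<kappa>0 jump_powr_nonneg[of \<delta> \<epsilon> "x - z"] by simp
  consider "x = z" | "r / 2 \<le> norm (x - c) \<or> r / 2 \<le> norm (z - c)"
    | "x \<noteq> z" "norm (x - c) < r / 2" "norm (z - c) < r / 2"
    by linarith
  then show ?thesis
  proof cases
    case 1
    then show ?thesis using \<open>0 \<le> G x z\<close> by simp
  next
    case 2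
    then show ?thesis using far bounded[OF x] bounded[OF z] by linarith
  next
    case 3
    define h where "h = x - z"
    have Rn: "x \<in> Rn n" "z \<in> Rn n" using x z by (auto simp: ball_Rn_def)
    have h: "h \<in> Rn n" "h \<noteq> 0"
      using 3 Rn by (auto simp: h_def intro: subspace_diff[OF subspace_Rn])
    have "norm h \<le> r"
      using 3 norm_triangle_ineq4[of "x - c" "z - c"] by (simp add: h_def)
    have "\<epsilon> \<le> r" using \<epsilon> by simp
    have step: "y + \<epsilon> *\<^sub>R v \<in> ball_Rn n c r \<and> y - \<epsilon> *\<^sub>R v \<in> ball_Rn n c r"
      if "y \<in> Rn n" "norm (y - c) < r / 2" "v \<in> Rn n" "norm v = 1" for y v
    proof -
      have "norm (y - c + k) < r" if "norm k \<le> \<epsilon>" for k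
        using norm_triangle_ineq[of "y - c" k] that \<epsilon> \<open>norm (y - c) < r / 2\<close> by linarith
      from this[of "\<epsilon> *\<^sub>R v"] this[of "- (\<epsilon> *\<^sub>R v)"]
      have "norm (y - c + \<epsilon> *\<^sub>R v) < r" "norm (y - c - \<epsilon> *\<^sub>R v) < r"
        using that(4) \<epsilon>(1) by simp_all
      moreover have "y - c + \<epsilon> *\<^sub>R v = y + \<epsilon> *\<^sub>R v - c" "y - c - \<epsilon> *\<^sub>R v = y - \<epsilon> *\<^sub>R v - c"
        by simp_all
      moreover have "y + \<epsilon> *\<^sub>R v \<in> Rn n" "y - \<epsilon> *\<^sub>R v \<in> Rn n"
        using that(1,3) subspace_Rn by (simp_all add: subspace_add subspace_diff subspace_scale)
      ultimately show ?thesis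
        by (auto simp: ball_Rn_def dist_norm norm_minus_commute[of c])
    qed
    have average_le: "\<bar>symmetric_average \<epsilon> u y v\<bar> \<le> M"
      if "y \<in> Rn n" "norm (y - c) < r / 2" "v \<in> Rn n" "norm v = 1" for y v
    proof -
      have "\<bar>u (y + \<epsilon> *\<^sub>R v)\<bar> \<le> M" "\<bar>u (y - \<epsilon> *\<^sub>R v)\<bar> \<le> M"
        using step[OF that] bounded by blast+
      then show ?thesis by (simp add: symmetric_average_def abs_le_iff)
    qed
    define Q where "Q = \<kappa> * ((norm (x - c))\<^sup>2 + (norm (z - c))\<^sup>2 + 2 * \<epsilon>\<^sup>2) + \<theta>"
    have coupling: "symmetric_average \<epsilon> u x w \<le> symmetric_average \<epsilon> u z v +
      (L / 2 * (jump_powr \<delta> \<epsilon> (h + \<epsilon> *\<^sub>R (w - v)) + jump_powr \<delta> \<epsilon> (h - \<epsilon> *\<^sub>R (w - v))) + Q)"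
      if "w \<in> Rn n" "norm w = 1" "v \<in> Rn n" "norm v = 1" for w v
      unfolding h_def Q_def
      by (rule symmetric_average_le_coupling[where \<phi> = "jump_powr \<delta> \<epsilon>", OF u_le[unfolded G]
            step[OF Rn(1) 3(2)] step[OF Rn(2) 3(3)] that])
    obtain w\<^sub>0 v\<^sub>0 where wv0: "w\<^sub>0 \<in> Rn n" "norm w\<^sub>0 = 1" "v\<^sub>0 \<in> Rn n" "norm v\<^sub>0 = 1"
      and gain: "\<And>w v. norm w = 1 \<Longrightarrow> norm v = 1 \<Longrightarrow>
        2 * (jump_powr \<delta> \<epsilon> (h + \<epsilon> *\<^sub>R (w\<^sub>0 - v\<^sub>0)) + jump_powr \<delta> \<epsilon> (h - \<epsilon> *\<^sub>R (w\<^sub>0 - v\<^sub>0)))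
        + (jump_powr \<delta> \<epsilon> (h + \<epsilon> *\<^sub>R (w - v)) + jump_powr \<delta> \<epsilon> (h - \<epsilon> *\<^sub>R (w - v))
          + jump_powr \<delta> \<epsilon> (h + \<epsilon> *\<^sub>R (w + v)) + jump_powr \<delta> \<epsilon> (h - \<epsilon> *\<^sub>R (w + v)))
        \<le> 8 * jump_powr \<delta> \<epsilon> h - 4 * (\<delta> * (1 - 2 * \<delta>) * \<epsilon>\<^sup>2 * r powr (\<delta> - 2))"
      using jump_powr_directions[OF assms(1) h \<open>norm h \<le> r\<close> \<epsilon>(1) \<open>\<epsilon> \<le> r\<close> \<delta>] by blast
    define g where "g = \<delta> * (1 - 2 * \<delta>) * \<epsilon>\<^sup>2 * r powr (\<delta> - 2)"
    define J where "J = (jump_powr \<delta> \<epsilon> (h + \<epsilon> *\<^sub>R (w\<^sub>0 - v\<^sub>0)) + jump_powr \<delta> \<epsilon> (h - \<epsilon> *\<^sub>R (w\<^sub>0 - v\<^sub>0))) / 2"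
    \<comment> \<open>Since \<open>symmetric_average\<close> is even, the coupling holds for
      \<open>v\<close> and \<open>- v\<close>; the mean of both produces the four terms of
      \<open>gain\<close>. The term \<open>- J\<close> cancels against the cost of the chosen
      directions.\<close>
    have R2: "symmetric_average \<epsilon> u x w \<le> symmetric_average \<epsilon> u z v +
        (L * (2 * jump_powr \<delta> \<epsilon> h - g - J) + Q)"
      if wv: "w \<in> Rn n" "norm w = 1" "v \<in> Rn n" "norm v = 1" for w v
    proof -
      define P where "P = jump_powr \<delta> \<epsilon> (h + \<epsilon> *\<^sub>R (w - v)) + jump_powr \<delta> \<epsilon> (h - \<epsilon> *\<^sub>R (w - v))"
      define N where "N = jump_powr \<delta> \<epsilon> (h + \<epsilon> *\<^sub>R (w + v)) + jump_powr \<delta> \<epsilon> (h - \<epsilon> *\<^sub>R (w + v))"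
      have "symmetric_average \<epsilon> u x w \<le> symmetric_average \<epsilon> u z v + (L / 2 * P + Q)"
        unfolding P_def by (rule coupling[OF wv])
      moreover have "symmetric_average \<epsilon> u x w \<le> symmetric_average \<epsilon> u z v + (L / 2 * N + Q)"
        using coupling[OF wv(1,2) subspace_neg[OF subspace_Rn wv(3)]] wv(4)
        by (simp add: symmetric_average_def N_def add.commute[of "u (z - _)"])
      ultimately have "symmetric_average \<epsilon> u x w \<le> symmetric_average \<epsilon> u z v + (L * ((P + N) / 4) + Q)"
        by argo
      moreover have "(P + N) / 4 \<le> 2 * jump_powr \<delta> \<epsilon> h - g - J"
        using gain[OF wv(2,4)] unfolding g_def J_def P_def N_def by argo
      then have "L * ((P + N) / 4) \<le> L * (2 * jump_powr \<delta> \<epsilon> h - g - J)"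
        using L0 by (intro mult_left_mono) auto
      ultimately show ?thesis by linarith
    qed
    have "u x - u z \<le> (1 - 2 * m) * (L * jump_powr \<delta> \<epsilon> h + Q)
        + m * ((L * J + Q) + (L * (2 * jump_powr \<delta> \<epsilon> h - g - J) + Q))"
    proof (rule satisfies_DPP_difference_le[OF assms(1,2) _ _ \<alpha> _ m(2,3) average_le[OF Rn(1) 3(2)]
          average_le[OF Rn(2) 3(3)] _ wv0 _ R2])
      show "x \<in> \<Omega>" "z \<in> \<Omega>" using x z assms(3) by auto
      show "symmetric_average \<epsilon> u x v \<le> symmetric_average \<epsilon> u z v + (L * jump_powr \<delta> \<epsilon> h + Q)"
        if "v \<in> Rn n" "norm v = 1" for v
        using coupling[OF that that] by simp
      show "symmetric_average \<epsilon> u x w\<^sub>0 \<le> symmetric_average \<epsilon> u z v\<^sub>0 + (L * J + Q)"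
        using coupling[OF wv0] by (simp add: J_def)
    qed (use m in auto)
    also have "\<dots> = L * jump_powr \<delta> \<epsilon> h + Q - L * m * g"
      by (simp add: algebra_simps)
    \<comment> \<open>The 17 in \<open>L\<close> exceeds by one the 16 coming from
      \<open>2 * \<kappa> * \<epsilon>\<^sup>2\<close>; this surplus is the improvement.\<close>
    also have "L * m * g = 17 * M * \<epsilon>\<^sup>2 / r\<^sup>2"
      using m \<delta> r by (simp add: L g_def powr_diff powr_minus field_simps)
    also have "Q = \<kappa> * ((norm (x - c))\<^sup>2 + (norm (z - c))\<^sup>2) + 16 * M * \<epsilon>\<^sup>2 / r\<^sup>2 + \<theta>"
      by (simp add: Q_def \<kappa> algebra_simps)
    finally have "u x - u z \<le> G x z + (\<theta> - M * \<epsilon>\<^sup>2 / r\<^sup>2)"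
      by (simp add: G h_def)
    then show ?thesis by linarith
  qed
qed

text \<open>Starting from the trivial error \<open>2 * M\<close>, finitely many improvements by
  \<open>\<eta>\<close> bring it to zero. Their number depends on \<open>\<epsilon>\<close> but does
  not enter the bound.\<close>

lemma comparison:
  assumes "n \<ge> 2" "satisfies_DPP n \<alpha> \<Omega> \<epsilon> u" "ball_Rn n c r \<subseteq> \<Omega>"
    and "\<And>j. j \<in> {1..n} \<Longrightarrow> 0 \<le> \<alpha> j" "(\<Sum>j=1..n. \<alpha> j) = 1"
    and "0 < m" "m \<le> \<alpha> 1" "m \<le> \<alpha> n" "0 < \<delta>" "\<delta> < 1/2" "0 < \<epsilon>" "2 * \<epsilon> \<le> r"
    and bounded: "\<And>y. y \<in> ball_Rn n c r \<Longrightarrow> \<bar>u y\<bar> \<le> M" and "0 < M"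
    and L: "L = 17 * M / (m * \<delta> * (1 - 2 * \<delta>)) * r powr (- \<delta>)"
    and \<kappa>: "\<kappa> = 8 * M / r\<^sup>2"
    and x: "x \<in> ball_Rn n c r" and z: "z \<in> ball_Rn n c r"
  shows "u x - u z \<le> L * jump_powr \<delta> \<epsilon> (x - z) + \<kappa> * ((norm (x - c))\<^sup>2 + (norm (z - c))\<^sup>2)"
proof -
  define G where "G x z = L * jump_powr \<delta> \<epsilon> (x - z) + \<kappa> * ((norm (x - c))\<^sup>2 + (norm (z - c))\<^sup>2)" for x z
  define \<eta> where "\<eta> = M * \<epsilon>\<^sup>2 / r\<^sup>2"
  have "0 < \<eta>" using assms by (simp add: \<eta>_def)
  have iterate: "\<forall>x\<in>ball_Rn n c r. \<forall>z\<in>ball_Rn n c r. u x - u z \<le> G x z + max 0 (2 * M - real k * \<eta>)" for k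
  proof (induction k)
    case 0
    have "0 \<le> G x z" for x z
      unfolding G_def using jump_powr_nonneg[of \<delta> \<epsilon> "x - z"] assms by simp
    moreover have "u x - u z \<le> 2 * M" if "x \<in> ball_Rn n c r" "z \<in> ball_Rn n c r" for x z
      using bounded[OF that(1)] bounded[OF that(2)] by linarith
    ultimately show ?case
      using \<open>0 < M\<close> by (simp add: add_increasing)
  next
    case (Suc k)
    show ?case
    proof (intro ballI)
      fix x z assume xz: "x \<in> ball_Rn n c r" "z \<in> ball_Rn n c r"
      have "u x - u z \<le> G x z + max 0 (max 0 (2 * M - real k * \<eta>) - \<eta>)"
        unfolding \<eta>_def
        by (rule comparison_improvement[OF assms(1-16) G_def, where \<theta> = "max 0 (2 * M - real k * (M * \<epsilon>\<^sup>2 / r\<^sup>2))"])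
          (use Suc.IH xz in \<open>auto simp: \<eta>_def\<close>)
      also have "max 0 (max 0 (2 * M - real k * \<eta>) - \<eta>) = max 0 (2 * M - real (Suc k) * \<eta>)"
        using \<open>0 < \<eta>\<close> by (auto simp: max_def algebra_simps)
      finally show "u x - u z \<le> G x z + max 0 (2 * M - real (Suc k) * \<eta>)" .
    qed
  qed
  obtain k :: nat where "2 * M < real k * \<eta>"
    using reals_Archimedean3[OF \<open>0 < \<eta>\<close>] by blast
  then have "max 0 (2 * M - real k * \<eta>) = 0" by simp
  then show ?thesis
    using iterate[of k] x z by (auto simp: G_def)
qed

section \<open>The Hoelder estimate\<close>

text \<open>Centred at the midpoint, the quadratic term is of order
  \<open>(norm (x - z) / r)\<^sup>2\<close> and is absorbed by the Hoelder term. The 119 is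
  \<open>7 * 17\<close>: one part for the power and six for the jump.\<close>

lemma DPP_Hoelder_one_sided:
  assumes "n \<ge> 2" "satisfies_DPP n \<alpha> \<Omega> \<epsilon> u" "ball_Rn n c (2 * r) \<subseteq> \<Omega>"
    and "\<And>j. j \<in> {1..n} \<Longrightarrow> 0 \<le> \<alpha> j" "(\<Sum>j=1..n. \<alpha> j) = 1"
    and "0 < m" "m \<le> \<alpha> 1" "m \<le> \<alpha> n" "0 < \<delta>" "\<delta> < 1/2" "0 < \<epsilon>" "0 < r"
    and bounded: "\<And>y. y \<in> ball_Rn n c (2 * r) \<Longrightarrow> \<bar>u y\<bar> \<le> M" and "0 < M"
    and x: "x \<in> ball_Rn n c r" and z: "z \<in> ball_Rn n c r"
  shows "u x - u z \<le> (119 / (m * \<delta> * (1 - 2 * \<delta>)) + 16) * M *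
    (norm (x - z) powr \<delta> / r powr \<delta> + \<epsilon> powr \<delta> / r powr \<delta>)"
proof -
  define K where "K = 17 / (m * \<delta> * (1 - 2 * \<delta>))"
  define s t where "s = norm (x - z) powr \<delta> / r powr \<delta>" and "t = \<epsilon> powr \<delta> / r powr \<delta>"
  have K: "0 < K" using assms by (simp add: K_def)
  have st: "0 \<le> s" "0 \<le> t" by (simp_all add: s_def t_def)
  have "u x - u z \<le> M * (K * s + 6 * K * t + 16 * s + 16 * t)"
  proof (cases "2 * \<epsilon> \<le> r")
    case True
    define c' where "c' = (1/2) *\<^sub>R (x + z)"
    have Rn: "x \<in> Rn n" "z \<in> Rn n" and norms: "norm (x - c) < r" "norm (z - c) < r"
      using x z by (auto simp: ball_Rn_def dist_norm norm_minus_commute)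
    have "norm ((x - c) - (z - c)) < 2 * r"
      using norm_triangle_ineq4[of "x - c" "z - c"] norms by simp
    then have d: "norm (x - z) < 2 * r" by simp
    have xz: "x - c' = (1/2) *\<^sub>R (x - z)" "z - c' = (1/2) *\<^sub>R (z - x)"
      by (auto simp: c'_def algebra_simps simp flip: scaleR_add_left)
    then have norm_xz: "norm (x - c') = norm (x - z) / 2" "norm (z - c') = norm (x - z) / 2"
      by (simp_all add: norm_minus_commute)
    have "c' - c = (1/2) *\<^sub>R (x - c) + (1/2) *\<^sub>R (z - c)"
      by (simp add: c'_def algebra_simps flip: scaleR_add_left)
    then have "norm (c' - c) < r"
      using norm_triangle_ineq[of "(1/2) *\<^sub>R (x - c)" "(1/2) *\<^sub>R (z - c)"] norms by simp
    then have sub: "ball_Rn n c' r \<subseteq> ball_Rn n c (2 * r)"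
      unfolding ball_Rn_def using dist_triangle_less_add[of _ c' r c r]
      by (force simp: dist_norm norm_minus_commute)
    have in_ball: "x \<in> ball_Rn n c' r" "z \<in> ball_Rn n c' r"
      using norm_xz d Rn by (auto simp: ball_Rn_def dist_norm norm_minus_commute)
    have "u x - u z \<le> 17 * M / (m * \<delta> * (1 - 2 * \<delta>)) * r powr (- \<delta>) * jump_powr \<delta> \<epsilon> (x - z)
        + 8 * M / r\<^sup>2 * ((norm (x - c'))\<^sup>2 + (norm (z - c'))\<^sup>2)"
      by (rule comparison[OF assms(1,2) _ assms(4-11) True bounded \<open>0 < M\<close> refl refl in_ball])
        (use sub assms(3) in blast)+
    also have "17 * M / (m * \<delta> * (1 - 2 * \<delta>)) * r powr (- \<delta>) * jump_powr \<delta> \<epsilon> (x - z)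
        \<le> 17 * M / (m * \<delta> * (1 - 2 * \<delta>)) * r powr (- \<delta>) * (norm (x - z) powr \<delta> + 6 * \<epsilon> powr \<delta>)"
      using assms by (intro mult_left_mono jump_powr_le) auto
    also have "\<dots> = M * (K * s + 6 * K * t)"
      by (simp add: K_def s_def t_def powr_minus divide_inverse algebra_simps)
    also have "8 * M / r\<^sup>2 * ((norm (x - c'))\<^sup>2 + (norm (z - c'))\<^sup>2) = M * (16 * (norm (x - z) / (2 * r))\<^sup>2)"
      unfolding norm_xz by (simp add: power2_eq_square field_simps)
    finally have u_le: "u x - u z \<le> M * (K * s + 6 * K * t)
        + M * (16 * (norm (x - z) / (2 * r))\<^sup>2)"
      by simp
    have "(norm (x - z) / (2 * r))\<^sup>2 \<le> s"
    proof -
      \<comment> \<open>Two points of a ball of radius \<open>r\<close> make the base less than 1,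
        so lowering the exponent increases the power.\<close>
      have "(norm (x - z) / (2 * r)) powr 2 \<le> (norm (x - z) / (2 * r)) powr \<delta>"
        using d assms by (intro powr_mono') auto
      also have "\<dots> \<le> (norm (x - z) / r) powr \<delta>"
        using assms by (intro powr_mono2) (auto simp: field_simps)
      finally show ?thesis
        using assms by (simp add: s_def powr_divide powr_numeral power_divide power_mult_distrib)
    qed
    then have "16 * (norm (x - z) / (2 * r))\<^sup>2 \<le> 16 * s + 16 * t" using st by linarith
    then have "M * (16 * (norm (x - z) / (2 * r))\<^sup>2) \<le> M * (16 * s + 16 * t)"
      using \<open>0 < M\<close> by (intro mult_left_mono) auto
    with u_le have "u x - u z \<le> M * (K * s + 6 * K * t) + M * (16 * s + 16 * t)"
      by linarith
    then show ?thesis by (simp only: distrib_left add.assoc)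
  next
    case False
    \<comment> \<open>For \<open>\<epsilon>\<close> above \<open>r / 2\<close> the estimate is
      trivial: \<open>16 * t\<close> alone covers the oscillation \<open>2 * M\<close>, measured in
      units of \<open>M\<close>.\<close>
    have "1/2 = (1/2 :: real) powr 1" by simp
    also have "\<dots> \<le> (1/2) powr \<delta>" using assms by (intro powr_mono') auto
    also have "\<dots> \<le> (\<epsilon> / r) powr \<delta>"
      using False assms by (intro powr_mono2) (auto simp: field_simps)
    finally have "1/2 \<le> t" using assms by (simp add: t_def powr_divide)
    then have "2 \<le> K * s + 6 * K * t + 16 * s + 16 * t"
      using st K mult_nonneg_nonneg[of K s] mult_nonneg_nonneg[of K t] by linarith
    then have "M * 2 \<le> M * (K * s + 6 * K * t + 16 * s + 16 * t)"
      using \<open>0 < M\<close> by (intro mult_left_mono) auto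
    moreover have "\<bar>u x\<bar> \<le> M" "\<bar>u z\<bar> \<le> M"
      using x z \<open>0 < r\<close> by (auto intro!: bounded simp: ball_Rn_def)
    ultimately show ?thesis by linarith
  qed
  also have "\<dots> \<le> M * ((7 * K + 16) * (s + t))"
    using st K \<open>0 < M\<close> by (intro mult_left_mono) (auto simp: algebra_simps)
  finally show ?thesis
    by (simp add: K_def s_def t_def mult_ac)
qed

text \<open>\<open>a\<^sub>1\<close> and \<open>a\<^sub>n\<close> are fixed before \<open>C\<close>,
  whereas \<open>n\<close> and the weights are quantified after it; this expresses that the constant
  does not depend on the dimension.\<close>

theorem mainTheorem1:
  fixes \<delta> a\<^sub>1 a\<^sub>n :: real
  assumes "0 < \<delta>" "\<delta> < 1/2"
  shows "\<exists>C>0. \<forall>n\<ge>2. \<forall>\<alpha> :: nat \<Rightarrow> real.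
    (\<forall>j\<in>{1..n}. 0 \<le> \<alpha> j) \<and> min (\<alpha> 1) (\<alpha> n) > 0 \<and> (\<Sum>j=1..n. \<alpha> j) = 1 \<and>
    \<alpha> 1 = a\<^sub>1 \<and> \<alpha> n = a\<^sub>n \<longrightarrow>
    (\<forall>\<Omega> \<epsilon> u. bounded_domain n \<Omega> \<and> 0 < \<epsilon> \<and> satisfies_DPP n \<alpha> \<Omega> \<epsilon> u \<longrightarrow>
      (\<forall>c\<in>Rn n. \<forall>r>0. ball_Rn n c (2 * r) \<subseteq> \<Omega> \<longrightarrow>
        (\<forall>x\<in>ball_Rn n c r. \<forall>z\<in>ball_Rn n c r.
          ereal \<bar>u x - u z\<bar> \<le>
            ereal C * sup_norm_on (ball_Rn n c (2 * r)) u *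
            ereal (norm (x - z) powr \<delta> / r powr \<delta> + \<epsilon> powr \<delta> / r powr \<delta>))))"
proof (cases "0 < min a\<^sub>1 a\<^sub>n")
  case False
  \<comment> \<open>No admissible weights exist in this case, so any positive constant
    serves.\<close>
  then show ?thesis by (intro exI[of _ 1]) auto
next
  case True
  define m where "m = min a\<^sub>1 a\<^sub>n"
  define C where "C = 119 / (m * \<delta> * (1 - 2 * \<delta>)) + 16"
  have m: "0 < m" using True by (simp add: m_def)
  then have "0 \<le> 119 / (m * \<delta> * (1 - 2 * \<delta>))" using assms by simp
  then have C: "0 < C" unfolding C_def by (rule add_nonneg_pos) simp
  have "ereal \<bar>u x - u z\<bar> \<le> ereal C * sup_norm_on (ball_Rn n c (2 * r)) u *
      ereal (norm (x - z) powr \<delta> / r powr \<delta> + \<epsilon> powr \<delta> / r powr \<delta>)"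
    if n: "n \<ge> 2" and \<alpha>: "\<forall>j\<in>{1..n}. 0 \<le> \<alpha> j" "(\<Sum>j=1..n. \<alpha> j) = 1" "\<alpha> 1 = a\<^sub>1" "\<alpha> n = a\<^sub>n"
      and \<epsilon>: "0 < \<epsilon>" and DPP: "satisfies_DPP n \<alpha> \<Omega> \<epsilon> u" and r: "0 < r"
      and \<Omega>: "ball_Rn n c (2 * r) \<subseteq> \<Omega>" and xz: "x \<in> ball_Rn n c r" "z \<in> ball_Rn n c r"
    for n c r x z \<epsilon> u \<Omega> and \<alpha> :: "nat \<Rightarrow> real"
  proof -
    define N where "N = sup_norm_on (ball_Rn n c (2 * r)) u"
    define T where "T = norm (x - z) powr \<delta> / r powr \<delta> + \<epsilon> powr \<delta> / r powr \<delta>"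
    \<comment> \<open>Strictness matters: in \<open>ereal\<close> infinity times 0 is 0, which would
      spoil the case of unbounded \<open>u\<close>.\<close>
    have "0 < T" using \<epsilon> r by (simp add: T_def add_nonneg_pos)
    have u_le: "ereal \<bar>u y\<bar> \<le> N" if "y \<in> ball_Rn n c (2 * r)" for y
      unfolding N_def sup_norm_on_def using that by (rule SUP_upper)
    have in_ball: "x \<in> ball_Rn n c (2 * r)" "z \<in> ball_Rn n c (2 * r)"
      using xz r by (auto simp: ball_Rn_def)
    have "0 \<le> N" using u_le[OF in_ball(1)] by (rule order_trans[rotated]) simp
    \<comment> \<open>The iteration improves by multiples of \<open>M\<close> and needs
      \<open>M > 0\<close>, hence the separate case \<open>N = 0\<close>.\<close>
    then consider "N = \<infinity>" | "N = 0" | M where "N = ereal M" "0 < M"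
      by (cases N) (auto simp: less_le)
    then have "ereal \<bar>u x - u z\<bar> \<le> ereal C * N * ereal T"
    proof cases
      case 1
      then show ?thesis using C \<open>0 < T\<close> by simp
    next
      case 2
      then have "u x = 0" "u z = 0" using u_le in_ball by force+
      then show ?thesis using 2 by simp
    next
      case 3
      have bounded: "\<bar>u y\<bar> \<le> M" if "y \<in> ball_Rn n c (2 * r)" for y
        using u_le[OF that] 3 by simp
      have m_le: "m \<le> \<alpha> 1" "m \<le> \<alpha> n" using \<alpha> by (simp_all add: m_def)
      have one_sided: "u y - u y' \<le> C * M * (norm (y - y') powr \<delta> / r powr \<delta> + \<epsilon> powr \<delta> / r powr \<delta>)"
        if "y \<in> ball_Rn n c r" "y' \<in> ball_Rn n c r" for y y'
        unfolding C_def using \<alpha>(1)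
        by (intro DPP_Hoelder_one_sided[OF n DPP \<Omega> _ \<alpha>(2) m m_le assms \<epsilon> r bounded 3(2) that]) auto
      have "\<bar>u x - u z\<bar> \<le> C * M * T"
        using one_sided[OF xz] one_sided[OF xz(2,1)]
        by (simp add: T_def norm_minus_commute abs_le_iff)
      then show ?thesis using 3 by simp
    qed
    then show ?thesis by (simp add: N_def T_def)
  qed
  then show ?thesis using C by (intro exI[of _ C]) auto
qed

end
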